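(* Let $n\ge 6$ be even. (i) If arbitrary complex weights are allowed, a $p\times q$ rectangle admits a signed tiling by $\mathcal{T}_n$ if and only if $n$ divides $p$ or $n$ divides $q$. (ii) With integer weights: if $R$ is a rectangle with a side divisible by $n$ and $c$ is an integer multiple of $\frac{n}{2}-2$, then the weighted region assigning weight $c$ to every cell of $R$ (and $0$ elsewhere) admits a signed tiling by $\mathcal{T}_n$ with integer weights.
   Context: Identify the unit cell $[a,a+1]\times[b,b+1]$ with $(a,b)\in\mathbb{Z}^2$. For $n$ even, $\mathcal{T}_n$ consists of all integer translates of the polyominoes with cell sets $\{(0,j):0\le j\le n-2\}\cup\{(1,0)\}$, $\{(1,j):0\le j\le n-2\}\cup\{(0,n-2)\}$, $\{(i,0):0\le i\le n-2\}\cup\{(0,1)\}$, $\{(i,1):0\le i\le n-2\}\cup\{(n-2,0)\}$ (translations only). A signed tiling with weights in a ring $A$ ($A=\mathbb{C}$ or $\mathbb{Z}$) of a weighted region $w:\mathbb{Z}^2\to A$ (finitely supported) is a finite collection of translated tiles, each with a weight in $A$, such that for every cell the sum of the weights of the tiles containing it equals $w$ of that cell. A rectangle $R$ is tiled when $w$ is $1$ on $R$ and $0$ elsewhere. *)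

theory Defs
  imports Complex_Main
begin

(* The pair (a, b) stands for the unit cell [a, a+1] x [b, b+1]. *)
type_synonym cell = "int \<times> int"

definition translate :: "int \<times> int \<Rightarrow> cell set \<Rightarrow> cell set" where
  "translate v P = (\<lambda>(a, b). (a + fst v, b + snd v)) ` P"

definition base_tiles :: "nat \<Rightarrow> cell set set" where
  "base_tiles n =
     {{(0, j) | j. 0 \<le> j \<and> j \<le> int n - 2} \<union> {(1, 0)},
      {(1, j) | j. 0 \<le> j \<and> j \<le> int n - 2} \<union> {(0, int n - 2)},
      {(i, 0) | i. 0 \<le> i \<and> i \<le> int n - 2} \<union> {(0, 1)},
      {(i, 1) | i. 0 \<le> i \<and> i \<le> int n - 2} \<union> {(int n - 2, 0)}}"

definition tiles :: "nat \<Rightarrow> cell set set" where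
  "tiles n = {translate v P | v P. P \<in> base_tiles n}"

(* The ring of weights is the type 'a. The collection is a finite set F of tiles, each carrying a
   single weight: repeated copies of a tile can be merged by adding up their weights. The region w
   is then automatically finitely supported, the tiles being finite. *)
definition is_signed_tiling ::
  "cell set set \<Rightarrow> cell set set \<Rightarrow> (cell set \<Rightarrow> 'a::comm_ring_1) \<Rightarrow> (cell \<Rightarrow> 'a) \<Rightarrow> bool" where
  "is_signed_tiling T F u w \<longleftrightarrow>
     finite F \<and> F \<subseteq> T \<and> (\<forall>z. (\<Sum>t\<in>{t \<in> F. z \<in> t}. u t) = w z)"

definition admits_signed_tiling :: "cell set set \<Rightarrow> (cell \<Rightarrow> 'a::comm_ring_1) \<Rightarrow> bool" where
  "admits_signed_tiling T w \<longleftrightarrow> (\<exists>F u. is_signed_tiling T F u w)"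

(* p columns and q rows, lower left cell (a, b) *)
definition rectangle :: "int \<Rightarrow> int \<Rightarrow> nat \<Rightarrow> nat \<Rightarrow> cell set" where
  "rectangle a b p q = {a..<a + int p} \<times> {b..<b + int q}"

definition constant_region :: "cell set \<Rightarrow> 'a::comm_ring_1 \<Rightarrow> cell \<Rightarrow> 'a" where
  "constant_region R c = (\<lambda>z. if z \<in> R then c else 0)"

end

theory Submission
  imports Defs "HOL-Library.Poly_Mapping" "HOL-Library.Product_Plus" "HOL-Analysis.Complex_Transcendental"
begin

text \<open>
  Identify finitely supported regions with elements of the group ring of the grid, that is, with
  Laurent polynomials in X and Y. The tileable ones form the ideal J generated by the polynomials
  of the four base tiles. Put n = 2k + 2 and D = XY - 1. Modulo J both X and Y act on D as -1,
  hence D squared vanishes and (XY)^i = 1 + iD. A bar of length n is congruent to -D, and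
  multiplying the third tile polynomial by Y^(n-2) yields (k - 1) D = 0, where k - 1 = n/2 - 2.
  Conversely, every tile polynomial vanishes at (w, 1/w) for a primitive n-th root of unity w,
  whereas a rectangle with neither side divisible by n does not.
\<close>

section \<open>The ideal computation in an arbitrary commutative ring\<close>

lemma module_times: "module ((*) :: 'a::comm_ring_1 \<Rightarrow> 'a \<Rightarrow> 'a)"
  by unfold_locales (simp_all add: algebra_simps)

lemma alternating_sum: "(\<Sum>i<2*k+1. of_nat i * (-1)^i) = (of_nat k :: 'a::comm_ring_1)"
  by (induction k) (simp_all add: algebra_simps)

lemma bar_mem_ideal:
  fixes x y :: "'a::comm_ring_1" and k :: nat
  assumes J: "module.subspace (*) J"
    and P1: "(\<Sum>j<2*k+1. y^j) + x \<in> J"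
    and P2: "x * (\<Sum>j<2*k+1. y^j) + y^(2*k) \<in> J"
    and P3: "(\<Sum>i<2*k+1. x^i) + y \<in> J"
    and P4: "y * (\<Sum>i<2*k+1. x^i) + x^(2*k) \<in> J"
  shows "(of_nat k - 1) * (\<Sum>i<2*k+2. x^i) \<in> J"
proof -
  note zero = module.subspace_0 [OF module_times J]
    and add = module.subspace_add [OF module_times J]
    and diff = module.subspace_diff [OF module_times J]
    and mult = module.subspace_scale [OF module_times J]
  define D where "D = x * y - 1"
  define sx sy px py where "sx = (\<Sum>i<2*k+1. x^i)" and "sy = (\<Sum>i<2*k+1. y^i)"
    and "px = x^(2*k)" and "py = y^(2*k)"
  note s_defs = this
  note P = P1 [folded s_defs] P2 [folded s_defs] P3 [folded s_defs] P4 [folded s_defs]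
  have sx: "(x - 1) * sx = x * px - 1" and sy: "(y - 1) * sy = y * py - 1"
    unfolding s_defs by (subst power_diff_1_eq [symmetric], simp)+
  \<comment> \<open>Eliminating the long bar between the two vertical tiles leaves y^(2k) congruent
    to x^2; the horizontal tiles give x^(2k) congruent to y^2.\<close>
  have "x^2 - py = x * (sy + x) - (x * sy + py)"
    by (simp add: algebra_simps power2_eq_square)
  then have x2: "x^2 - py \<in> J"
    using diff [OF mult [OF P(1), of x] P(2)] by (simp only:)
  have "y^2 - px = y * (sx + y) - (y * sx + px)"
    by (simp add: algebra_simps power2_eq_square)
  then have y2: "y^2 - px \<in> J"
    using diff [OF mult [OF P(3), of y] P(4)] by (simp only:)
  \<comment> \<open>The factor y - 1 telescopes the bar to y^(2k+1) - 1, and y^(2k+1) is congruent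
    to x^2 y. So x acts on D as -1.\<close>
  have "(x + 1) * D = (y - 1) * (sy + x) + y * (x^2 - py)"
    unfolding distrib_left [of "y - 1"] sy D_def by (simp add: algebra_simps power2_eq_square)
  then have xD: "(x + 1) * D \<in> J"
    using add [OF mult [OF P(1), of "y - 1"] mult [OF x2, of y]] by (simp only:)
  have "(y + 1) * D = (x - 1) * (sx + y) + x * (y^2 - px)"
    unfolding distrib_left [of "x - 1"] sx D_def by (simp add: algebra_simps power2_eq_square)
  then have yD: "(y + 1) * D \<in> J"
    using add [OF mult [OF P(3), of "x - 1"] mult [OF y2, of x]] by (simp only:)
  \<comment> \<open>Since y(x + 1) - (y + 1) = xy - 1 = D.\<close>
  have DD: "D * D \<in> J"
    using diff [OF mult [OF xD, of y] yD] by (simp add: D_def algebra_simps)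
  have yiD: "(y^i - (-1)^i) * D \<in> J" for i
  proof (induction i)
    case 0
    show ?case using zero by simp
  next
    case (Suc i)
    have "(y^Suc i - (-1)^Suc i) * D = y * ((y^i - (-1)^i) * D) + (-1)^i * ((y + 1) * D)"
      by (simp add: algebra_simps)
    then show ?case using add [OF mult [OF Suc, of y] mult [OF yD, of "(-1)^i"]] by (simp only:)
  qed
  \<comment> \<open>The binomial expansion of (1 + D)^i, cut off after the linear term because D^2
    lies in J.\<close>
  have xyi: "(x * y)^i - 1 - of_nat i * D \<in> J" for i
  proof (induction i)
    case 0
    show ?case using zero by simp
  next
    case (Suc i)
    have "(x * y)^Suc i - 1 - of_nat (Suc i) * D
        = (x * y) * ((x * y)^i - 1 - of_nat i * D) + of_nat i * (D * D)"
      by (simp add: D_def algebra_simps)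
    then show ?case using add [OF mult [OF Suc, of "x * y"] mult [OF DD, of "of_nat i"]] by (simp only:)
  qed
  \<comment> \<open>Write y^(2k) x^i as y^(2k-i) (xy)^i, which is congruent to y^(2k-i) (1 + iD),
    and let y^(2k-i) act on D as (-1)^(2k-i) = (-1)^i. Here i is at most 2k, so the subtraction is
    not truncated. Summing over i, \<open>alternating_sum\<close> gives the coefficient k of
    D.\<close>
  have step: "y^(2*k) * x^i - y^(2*k - i) - of_nat i * (-1)^i * D \<in> J" if "i < 2*k+1" for i
  proof -
    have e: "y^(2*k) = y^(2*k - i) * y^i" using that by (simp flip: power_add)
    have s: "(-1)^(2*k - i) = (-1 :: 'a)^i" using that by (auto simp: minus_one_power_iff)
    have "y^(2*k) * x^i - y^(2*k - i) - of_nat i * (-1)^i * D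
        = y^(2*k - i) * ((x * y)^i - 1 - of_nat i * D)
          + of_nat i * ((y^(2*k - i) - (-1)^(2*k - i)) * D)"
      unfolding e s by (simp add: algebra_simps power_mult_distrib)
    then show ?thesis
      using add [OF mult [OF xyi, of "y^(2*k - i)" i] mult [OF yiD, of "of_nat i" "2*k - i"]] by (simp only:)
  qed
  have "(\<Sum>i<2*k+1. y^(2*k) * x^i - y^(2*k - i) - of_nat i * (-1)^i * D) \<in> J"
    by (intro module.subspace_sum [OF module_times J] step) simp
  also have "(\<Sum>i<2*k+1. y^(2*k) * x^i - y^(2*k - i) - of_nat i * (-1)^i * D)
      = py * sx - (\<Sum>i<2*k+1. y^(2*k - i)) - of_nat k * D"
    by (simp only: sum_subtractf s_defs sum_distrib_left alternating_sum flip: sum_distrib_right)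
  also have "(\<Sum>i<2*k+1. y^(2*k - i)) = sy"
    using sum.nat_diff_reindex [of "\<lambda>i. y^i" "2*k+1"] by (simp add: s_defs)
  finally have A: "py * sx - sy - of_nat k * D \<in> J" .
  \<comment> \<open>Modulo J, sx is -y and sy is -x. Hence kD is congruent to x - y^(2k+1), that is
    to x - x^2 y = -xD, which is D again.\<close>
  have "(of_nat k - 1) * D = py * (sx + y) - (sy + x) + y * (x^2 - py)
      - (py * sx - sy - of_nat k * D) - (x + 1) * D"
    by (simp add: D_def algebra_simps power2_eq_square)
  then have kD: "(of_nat k - 1) * D \<in> J"
    using diff [OF diff [OF add [OF diff [OF mult [OF P(3), of py] P(1)] mult [OF x2, of y]] A] xD]
    by (simp only:)
  have "(\<Sum>i<2*k+2. x^i) = sx + x * px"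
    by (simp add: s_defs)
  \<comment> \<open>A bar of length n is thus congruent to yD, which k - 1 annihilates.\<close>
  also have "\<dots> = (sx + y) - x * (y^2 - px) + y * D"
    by (simp add: D_def algebra_simps power2_eq_square)
  finally have "(of_nat k - 1) * (\<Sum>i<2*k+2. x^i)
      = (of_nat k - 1) * ((sx + y) - x * (y^2 - px)) + y * ((of_nat k - 1) * D)"
    by (simp only: distrib_left mult.left_commute)
  then show ?thesis
    using add [OF mult [OF diff [OF P(3) mult [OF y2, of x]], of "of_nat k - 1"] mult [OF kD, of y]]
    by (simp only:)
qed

section \<open>Tiles and rectangles as images of index sets\<close>

lemma translate_eq: "translate v t = (+) v ` t"
  unfolding translate_def by (rule image_cong) (simp_all add: prod_eq_iff case_prod_beta)

lemma translate_translate: "translate v (translate w t) = translate (v + w) t"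
  by (simp add: translate_eq image_image add.assoc)

lemma translate_0: "translate 0 t = t"
  by (simp add: translate_eq)

lemma translate_mem_tiles: "t \<in> tiles n \<Longrightarrow> translate v t \<in> tiles n"
  unfolding tiles_def by (fastforce simp: translate_translate)

lemma base_tiles_subset_tiles: "t \<in> base_tiles n \<Longrightarrow> t \<in> tiles n"
  unfolding tiles_def using translate_0 [of t] by blast

text \<open>Natural indices instead of bounded integers, so that bars become geometric sums of
  powers.\<close>

lemma column_eq: "{(a, j) | j. 0 \<le> j \<and> j \<le> int m} = (\<lambda>j. (a, int j)) ` {..<m+1}"
  by (force simp: image_iff Bex_def elim: nonneg_int_cases)

lemma row_eq: "{(i, b) | i. 0 \<le> i \<and> i \<le> int m} = (\<lambda>i. (int i, b)) ` {..<m+1}"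
  by (force simp: image_iff Bex_def elim: nonneg_int_cases)

lemma base_tiles_eq:
  "base_tiles (2*k+2) =
     {(\<lambda>j. (0, int j)) ` {..<2*k+1} \<union> {(1, 0)},
      (\<lambda>j. (1, int j)) ` {..<2*k+1} \<union> {(0, int (2*k))},
      (\<lambda>i. (int i, 0)) ` {..<2*k+1} \<union> {(0, 1)},
      (\<lambda>i. (int i, 1)) ` {..<2*k+1} \<union> {(int (2*k), 0)}}"
proof -
  have "int (2*k+2) - 2 = int (2*k)" by simp
  then show ?thesis unfolding base_tiles_def by (simp only: column_eq row_eq)
qed

lemma finite_tile: "t \<in> tiles n \<Longrightarrow> finite t"
proof -
  have "finite t" if "t \<in> base_tiles n" for t
  proof -
    have "{(a, j) | j. 0 \<le> j \<and> j \<le> int n - 2} = Pair a ` {0..int n - 2}"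
      and "{(i, a) | i. 0 \<le> i \<and> i \<le> int n - 2} = (\<lambda>i. (i, a)) ` {0..int n - 2}" for a :: int
      by auto
    then show ?thesis using that by (auto simp: base_tiles_def)
  qed
  then show "t \<in> tiles n \<Longrightarrow> finite t" by (auto simp: tiles_def translate_eq)
qed

lemma rectangle_eq:
  "rectangle a b p q = (\<lambda>(i, j). (a + int i, b + int j)) ` ({..<p} \<times> {..<q})"
proof -
  have "z \<in> (\<lambda>(i, j). (a + int i, b + int j)) ` ({..<p} \<times> {..<q})"
    if "z \<in> rectangle a b p q" for z
    using that
    by (intro image_eqI [of _ _ "(nat (fst z - a), nat (snd z - b))"]) (auto simp: rectangle_def)
  then show ?thesis by (auto simp: rectangle_def)
qed

lemma finite_rectangle: "finite (rectangle a b p q)"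
  by (simp add: rectangle_def)

section \<open>Tileable regions as an ideal of the group ring\<close>

definition cell_sum :: "'a::comm_ring_1 \<Rightarrow> cell set \<Rightarrow> (cell \<Rightarrow>\<^sub>0 'a)" where
  "cell_sum c t = (\<Sum>z\<in>t. Poly_Mapping.single z c)"

lemma lookup_cell_sum:
  "finite t \<Longrightarrow> Poly_Mapping.lookup (cell_sum c t) = constant_region t c"
  by (rule ext) (simp add: cell_sum_def lookup_sum lookup_single when_def constant_region_def)

lemma cell_sum_0: "cell_sum 0 t = 0"
  by (simp add: cell_sum_def)

lemma cell_sum_add: "cell_sum (c + d) t = cell_sum c t + cell_sum d t"
  by (simp add: cell_sum_def single_add sum.distrib)

text \<open>The product of \<open>poly_mapping\<close> is convolution over addition of cells, so a
  monomial acts by translating and rescaling.\<close>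

lemma single_times_cell_sum:
  "Poly_Mapping.single v c * cell_sum d t = cell_sum (c * d) (translate v t)"
  by (simp add: cell_sum_def translate_eq sum_distrib_left mult_single sum.reindex)

definition tileable :: "nat \<Rightarrow> (cell \<Rightarrow>\<^sub>0 'a::comm_ring_1) set" where
  "tileable n = {p. admits_signed_tiling (tiles n) (Poly_Mapping.lookup p)}"

text \<open>Collecting the coefficient of each cell turns the cellwise tiling condition into one
  identity in the group ring.\<close>

lemma tileable_iff:
  "p \<in> tileable n \<longleftrightarrow>
     (\<exists>F u. finite F \<and> F \<subseteq> tiles n \<and> p = (\<Sum>t\<in>F. cell_sum (u t) t))"
proof -
  have "(\<forall>z. (\<Sum>t\<in>{t \<in> F. z \<in> t}. u t) = Poly_Mapping.lookup p z) \<longleftrightarrow> p = (\<Sum>t\<in>F. cell_sum (u t) t)"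
    if "finite F" "F \<subseteq> tiles n" for F u
  proof -
    have "Poly_Mapping.lookup (\<Sum>t\<in>F. cell_sum (u t) t) z = (\<Sum>t\<in>{t \<in> F. z \<in> t}. u t)" for z
    proof -
      have "Poly_Mapping.lookup (\<Sum>t\<in>F. cell_sum (u t) t) z = (\<Sum>t\<in>F. if z \<in> t then u t else 0)"
        unfolding lookup_sum using that
        by (intro sum.cong) (auto simp: lookup_cell_sum finite_tile constant_region_def)
      then show ?thesis using that by (simp add: sum.inter_filter)
    qed
    then show ?thesis by (auto simp: poly_mapping_eq_iff fun_eq_iff)
  qed
  then show ?thesis
    unfolding tileable_def admits_signed_tiling_def is_signed_tiling_def mem_Collect_eq by blast
qed

lemma tile_tileable:
  assumes "t \<in> tiles n"
  shows "cell_sum c t \<in> tileable n"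
  unfolding tileable_iff by (rule exI [of _ "{t}"], rule exI [of _ "\<lambda>_. c"]) (simp add: assms)

lemma zero_tileable: "0 \<in> tileable n"
  unfolding tileable_iff by (rule exI [of _ "{}"]) simp

lemma add_tileable:
  assumes "p \<in> tileable n" and "q \<in> tileable n"
  shows "p + q \<in> tileable n"
proof -
  obtain F u where F: "finite F" "F \<subseteq> tiles n" and p: "p = (\<Sum>t\<in>F. cell_sum (u t) t)"
    using assms(1) by (auto simp: tileable_iff)
  obtain G v where G: "finite G" "G \<subseteq> tiles n" and q: "q = (\<Sum>t\<in>G. cell_sum (v t) t)"
    using assms(2) by (auto simp: tileable_iff)
  \<comment> \<open>Both weights are extended by 0 to the union, where a tile common to F and G
    receives the sum of its weights.\<close>
  define u' v' where "u' t = (if t \<in> F then u t else 0)"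
    and "v' t = (if t \<in> G then v t else 0)" for t
  have "p = (\<Sum>t\<in>F \<union> G. cell_sum (u' t) t)"
    unfolding p using F G by (intro sum.mono_neutral_cong_left) (auto simp: u'_def cell_sum_0)
  moreover have "q = (\<Sum>t\<in>F \<union> G. cell_sum (v' t) t)"
    unfolding q using F G by (intro sum.mono_neutral_cong_left) (auto simp: v'_def cell_sum_0)
  ultimately have "p + q = (\<Sum>t\<in>F \<union> G. cell_sum (u' t + v' t) t)"
    by (simp add: cell_sum_add sum.distrib)
  then show ?thesis
    unfolding tileable_iff using F G
    by (intro exI [of _ "F \<union> G"] exI [of _ "\<lambda>t. u' t + v' t"]) auto
qed

lemma sum_tileable: "(\<And>i. i \<in> I \<Longrightarrow> f i \<in> tileable n) \<Longrightarrow> sum f I \<in> tileable n"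
  by (induction I rule: infinite_finite_induct) (auto intro: zero_tileable add_tileable)

lemma sum_single_keys:
  "q = (\<Sum>z\<in>Poly_Mapping.keys q. Poly_Mapping.single z (Poly_Mapping.lookup q z))"
  by (rule poly_mapping_eqI) (auto simp: lookup_sum lookup_single when_def in_keys_iff)

text \<open>Each monomial of q moves the tiles to other tiles, the tile set being closed under
  translation. Translates that coincide are merged by \<open>sum_tileable\<close>.\<close>

lemma mult_tileable:
  assumes "p \<in> tileable n"
  shows "q * p \<in> tileable n"
proof -
  obtain F u where F: "F \<subseteq> tiles n" and p: "p = (\<Sum>t\<in>F. cell_sum (u t) t)"
    using assms by (auto simp: tileable_iff)
  have "q * p = (\<Sum>z\<in>Poly_Mapping.keys q. \<Sum>t\<in>F. cell_sum (Poly_Mapping.lookup q z * u t) (translate z t))"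
    by (subst sum_single_keys [of q]) (simp add: p sum_product single_times_cell_sum)
  then show ?thesis
    using F by (auto intro!: sum_tileable tile_tileable translate_mem_tiles)
qed

lemma subspace_tileable: "module.subspace (*) (tileable n)"
  unfolding module.subspace_def [OF module_times]
  by (simp add: zero_tileable add_tileable mult_tileable)

section \<open>Laurent polynomials of rectangles and base tiles\<close>

definition X :: "cell \<Rightarrow>\<^sub>0 'a::comm_ring_1" where "X = Poly_Mapping.single (1, 0) 1"
definition Y :: "cell \<Rightarrow>\<^sub>0 'a::comm_ring_1" where "Y = Poly_Mapping.single (0, 1) 1"

lemma X_power: "X ^ i = Poly_Mapping.single (int i, 0) 1"
  by (induction i) (simp_all add: X_def mult_single zero_prod_def flip: single_one)

lemma Y_power: "Y ^ j = Poly_Mapping.single (0, int j) 1"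
  by (induction j) (simp_all add: Y_def mult_single zero_prod_def flip: single_one)

lemma monomial: "Poly_Mapping.single (a + int i, b + int j) c
    = Poly_Mapping.single (a, b) c * X ^ i * Y ^ j"
  by (simp add: X_power Y_power mult_single)

lemma cell_sum_rectangle:
  "cell_sum c (rectangle a b p q)
     = Poly_Mapping.single (a, b) c * (\<Sum>i<p. X ^ i) * (\<Sum>j<q. Y ^ j)"
proof -
  have "inj_on (\<lambda>(i, j). (a + int i, b + int j)) ({..<p} \<times> {..<q})"
    by (auto simp: inj_on_def)
  then have "cell_sum c (rectangle a b p q)
      = (\<Sum>(i, j)\<in>{..<p} \<times> {..<q}. Poly_Mapping.single (a, b) c * X ^ i * Y ^ j)"
    unfolding cell_sum_def rectangle_eq
    by (subst sum.reindex) (auto intro!: sum.cong simp: monomial)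
  also have "\<dots> = (\<Sum>i<p. \<Sum>j<q. Poly_Mapping.single (a, b) c * X ^ i * Y ^ j)"
    by (rule sum.cartesian_product [symmetric])
  also have "\<dots> = Poly_Mapping.single (a, b) c * (\<Sum>i<p. X ^ i) * (\<Sum>j<q. Y ^ j)"
    by (simp only: mult.assoc sum_product) (simp only: sum_distrib_left)
  finally show ?thesis .
qed

lemma base_tile_polynomials:
  fixes k :: nat
  defines "J \<equiv> tileable (2*k+2) :: (cell \<Rightarrow>\<^sub>0 'a::comm_ring_1) set"
  shows "(\<Sum>j<2*k+1. Y ^ j) + X \<in> J" and "X * (\<Sum>j<2*k+1. Y ^ j) + Y ^ (2*k) \<in> J"
    and "(\<Sum>i<2*k+1. X ^ i) + Y \<in> J" and "Y * (\<Sum>i<2*k+1. X ^ i) + X ^ (2*k) \<in> J"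
proof -
  \<comment> \<open>Every base tile is an injectively indexed bar of 2k + 1 cells together with one
    further cell z.\<close>
  have *: "(\<Sum>i<2*k+1. Poly_Mapping.single (g i) 1) + Poly_Mapping.single z 1 \<in> J"
    if tile: "g ` {..<2*k+1} \<union> {z} \<in> base_tiles (2*k+2)"
      and g: "inj g" "z \<notin> g ` {..<2*k+1}" for g :: "nat \<Rightarrow> cell" and z
  proof -
    have "cell_sum 1 (g ` {..<2*k+1} \<union> {z})
        = (\<Sum>i<2*k+1. Poly_Mapping.single (g i) 1) + Poly_Mapping.single z (1::'a)"
      using g unfolding cell_sum_def
      by (subst sum.union_disjoint) (auto simp: sum.reindex inj_on_subset)
    then show ?thesis
      using tile_tileable [OF base_tiles_subset_tiles [OF tile], of "1::'a"] by (simp add: J_def)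
  qed
  have "(\<Sum>j<2*k+1. Y ^ j) + (X :: cell \<Rightarrow>\<^sub>0 'a) =
      (\<Sum>j<2*k+1. Poly_Mapping.single (0, int j) 1) + Poly_Mapping.single (1, 0) 1"
    unfolding X_power Y_power unfolding X_def ..
  then show "(\<Sum>j<2*k+1. Y ^ j) + X \<in> J"
    by (simp only:) (rule *, unfold base_tiles_eq, auto simp: inj_def)
  have "X * (\<Sum>j<2*k+1. Y ^ j) + Y ^ (2*k) =
      (\<Sum>j<2*k+1. Poly_Mapping.single (1, int j) (1::'a)) + Poly_Mapping.single (0, int (2*k)) 1"
    unfolding X_power Y_power unfolding X_def sum_distrib_left mult_single by simp
  then show "X * (\<Sum>j<2*k+1. Y ^ j) + Y ^ (2*k) \<in> J"
    by (simp only:) (rule *, unfold base_tiles_eq, auto simp: inj_def)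
  have "(\<Sum>i<2*k+1. X ^ i) + (Y :: cell \<Rightarrow>\<^sub>0 'a) =
      (\<Sum>i<2*k+1. Poly_Mapping.single (int i, 0) 1) + Poly_Mapping.single (0, 1) 1"
    unfolding X_power Y_power unfolding Y_def ..
  then show "(\<Sum>i<2*k+1. X ^ i) + Y \<in> J"
    by (simp only:) (rule *, unfold base_tiles_eq, auto simp: inj_def)
  have "Y * (\<Sum>i<2*k+1. X ^ i) + X ^ (2*k) =
      (\<Sum>i<2*k+1. Poly_Mapping.single (int i, 1) (1::'a)) + Poly_Mapping.single (int (2*k), 0) 1"
    unfolding X_power Y_power unfolding Y_def sum_distrib_left mult_single by simp
  then show "Y * (\<Sum>i<2*k+1. X ^ i) + X ^ (2*k) \<in> J"
    by (simp only:) (rule *, unfold base_tiles_eq, auto simp: inj_def)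
qed

section \<open>Tilings of rectangles with a side divisible by n\<close>

lemma geometric_sum_dvd:
  fixes x :: "'a::comm_ring_1"
  assumes "n dvd p"
  shows "(\<Sum>i<n. x ^ i) dvd (\<Sum>i<p. x ^ i)"
proof -
  \<comment> \<open>A bar of length n + m is cut into a bar of length n and a shifted bar of length
    m; repeating this cuts a bar of length nr into r bars.\<close>
  have split: "(\<Sum>i<n + m. x ^ i) = (\<Sum>i<n. x ^ i) + x ^ n * (\<Sum>i<m. x ^ i)" for m
    by (induction m) (simp_all add: power_add algebra_simps)
  have "(\<Sum>i<n. x ^ i) dvd (\<Sum>i<n * r. x ^ i)" for r
    by (induction r) (simp_all add: split dvd_add)
  then show ?thesis using assms by auto
qed

text \<open>The ring is left general to serve both claims: over the complex numbers k - 1 is a unit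
  once k is at least 2, over the integers it is n/2 - 2.\<close>

lemma admits_signed_tiling_rectangle:
  fixes c :: "'a::comm_ring_1"
  assumes "2*k+2 dvd p \<or> 2*k+2 dvd q" and "of_nat k - 1 dvd c"
  shows "admits_signed_tiling (tiles (2*k+2)) (constant_region (rectangle a b p q) c)"
proof -
  define s where "s m x = (\<Sum>i<m. x ^ i)" for m and x :: "cell \<Rightarrow>\<^sub>0 'a"
  obtain d where c: "c = (of_nat k - 1) * d" using assms(2) by (elim dvdE)
  define M where "M = Poly_Mapping.single (a, b) d"
  \<comment> \<open>The scalar k - 1 of the weight ring is the monomial at the origin, which lets it
    be moved out of the weight c as a factor in the group ring.\<close>
  have "Poly_Mapping.single (0 :: cell) (of_nat k - 1 :: 'a) = of_nat k - 1"
    by (simp add: single_diff)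
  then have M: "Poly_Mapping.single (a, b) c = (of_nat k - 1) * M"
    using mult_single [of "0 :: cell" "of_nat k - 1 :: 'a" "(a, b)" d] by (simp add: M_def c)
  note P = base_tile_polynomials [of k, where 'a = 'a]
  have X: "(of_nat k - 1) * s (2*k+2) X \<in> tileable (2*k+2)"
    unfolding s_def by (rule bar_mem_ideal [OF subspace_tileable P])
  \<comment> \<open>The horizontal and vertical tiles trade places, as x and y do.\<close>
  have Y: "(of_nat k - 1) * s (2*k+2) Y \<in> tileable (2*k+2)"
    unfolding s_def by (rule bar_mem_ideal [OF subspace_tileable P(3,4,1,2)])
  have "(of_nat k - 1) * M * s p X * s q Y \<in> tileable (2*k+2)"
    using assms(1)
  proof
    assume "2*k+2 dvd p"
    then have "s (2*k+2) X dvd s p X"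
      unfolding s_def by (rule geometric_sum_dvd)
    then obtain f where "s p X = s (2*k+2) X * f" ..
    then show ?thesis using mult_tileable [OF X, of "M * f * s q Y"] by (simp add: ac_simps)
  next
    assume "2*k+2 dvd q"
    then have "s (2*k+2) Y dvd s q Y"
      unfolding s_def by (rule geometric_sum_dvd)
    then obtain f where "s q Y = s (2*k+2) Y * f" ..
    then show ?thesis using mult_tileable [OF Y, of "M * f * s p X"] by (simp add: ac_simps)
  qed
  then have "cell_sum c (rectangle a b p q) \<in> tileable (2*k+2)"
    by (simp only: cell_sum_rectangle M s_def)
  then show ?thesis by (simp add: tileable_def lookup_cell_sum finite_rectangle)
qed

section \<open>Necessity: a character of the grid that vanishes on all tiles\<close>

lemma signed_tiling_weighted_sum_eq_0:
  fixes h :: "cell \<Rightarrow> 'a::comm_ring_1"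
  assumes tiling: "admits_signed_tiling T (constant_region R (1::'a))" and "finite R"
    and T: "\<And>t. t \<in> T \<Longrightarrow> finite t" "\<And>t. t \<in> T \<Longrightarrow> (\<Sum>z\<in>t. h z) = 0"
  shows "(\<Sum>z\<in>R. h z) = 0"
proof -
  obtain F u where "is_signed_tiling T F u (constant_region R (1::'a))"
    using tiling unfolding admits_signed_tiling_def by blast
  then have F: "finite F" "F \<subseteq> T"
    and w: "(\<Sum>t\<in>{t \<in> F. z \<in> t}. u t) = constant_region R 1 z" for z
    by (simp_all only: is_signed_tiling_def)
  \<comment> \<open>Pairing with h is linear and kills every tile, hence every tileable region. U is
    a finite set containing all cells concerned, over which the double sum can be exchanged.\<close>
  define U where "U = R \<union> \<Union>F"
  have U: "finite U" using F T(1) \<open>finite R\<close> by (auto simp: U_def)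
  have "(\<Sum>z\<in>R. h z) = (\<Sum>z\<in>U. constant_region R 1 z * h z)"
    using U by (intro sum.mono_neutral_cong_left) (auto simp: U_def constant_region_def)
  also have "\<dots> = (\<Sum>z\<in>U. \<Sum>t\<in>F. if z \<in> t then u t * h z else 0)"
    using F by (intro sum.cong) (auto simp: w [symmetric] sum.inter_filter sum_distrib_right intro!: sum.cong)
  also have "\<dots> = (\<Sum>t\<in>F. \<Sum>z\<in>U. if z \<in> t then u t * h z else 0)"
    by (rule sum.swap)
  also have "\<dots> = (\<Sum>t\<in>F. u t * (\<Sum>z\<in>t. h z))"
  proof (rule sum.cong [OF refl])
    fix t assume "t \<in> F"
    then have "{z \<in> U. z \<in> t} = t" by (auto simp: U_def)
    then show "(\<Sum>z\<in>U. if z \<in> t then u t * h z else 0) = u t * (\<Sum>z\<in>t. h z)"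
      using U by (simp flip: sum.inter_filter add: sum_distrib_left)
  qed
  also have "\<dots> = 0" using F T(2) by (intro sum.neutral) auto
  finally show ?thesis .
qed

text \<open>The sum is the tile polynomial evaluated at X = w, Y = 1/w. In each base tile the long
  bar contributes exactly the negative of the extra cell.\<close>

lemma tile_character_sum_eq_0:
  fixes w :: "'a::field"
  assumes w: "w ^ (2*k+2) = 1" "w \<noteq> 1" and t: "t \<in> tiles (2*k+2)"
  shows "(\<Sum>(i, j)\<in>t. w powi (i - j)) = 0"
proof -
  have "w \<noteq> 0" using w(1) by auto
  \<comment> \<open>All 2k + 2 powers of v sum to 0; omitting the last one, v^(2k+1) = 1/v, leaves
    -1/v. It is applied to w for rows and to 1/w for columns.\<close>
  have geom: "(\<Sum>i<2*k+1. v ^ i) = - inverse v" if v: "v ^ (2*k+2) = 1" "v \<noteq> 1" for v :: 'a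
  proof -
    have "v \<noteq> 0" using v(1) by auto
    have "(\<Sum>i<2*k+2. v ^ i) = 0" using power_diff_1_eq [of v "2*k+2"] v by simp
    moreover have "v ^ (2*k+1) = inverse v"
      using v(1) \<open>v \<noteq> 0\<close> by (simp add: field_simps)
    ultimately show ?thesis by (simp add: eq_neg_iff_add_eq_0)
  qed
  have gw: "(\<Sum>i<2*k+1. w ^ i) = - inverse w" using geom w by blast
  have gi: "(\<Sum>i<2*k+1. inverse w ^ i) = - w"
    using geom [of "inverse w"] w by (simp only: power_inverse inverse_1 inverse_eq_1_iff inverse_inverse_eq simp_thms)
  have p: "w ^ (2*k) * w ^ 2 = 1" using w(1) by (simp flip: power_add)
  have base: "(\<Sum>(i, j)\<in>P. w powi (i - j)) = 0" if "P \<in> base_tiles (2*k+2)" for P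
  proof -
    have **: "(\<Sum>(i, j)\<in>g ` {..<2*k+1} \<union> {z}. w powi (i - j))
        = (\<Sum>i<2*k+1. w powi (fst (g i) - snd (g i))) + w powi (fst z - snd z)"
      if "inj g" "z \<notin> g ` {..<2*k+1}" for g :: "nat \<Rightarrow> cell" and z
      using that
      by (subst sum.union_disjoint) (auto simp: sum.reindex inj_on_subset case_prod_beta)
    from that consider
      "P = (\<lambda>j. (0, int j)) ` {..<2*k+1} \<union> {(1, 0)}"
      | "P = (\<lambda>j. (1, int j)) ` {..<2*k+1} \<union> {(0, int (2*k))}"
      | "P = (\<lambda>i. (int i, 0)) ` {..<2*k+1} \<union> {(0, 1)}"
      | "P = (\<lambda>i. (int i, 1)) ` {..<2*k+1} \<union> {(int (2*k), 0)}"
      unfolding base_tiles_eq by (elim insertE emptyE; simp only:)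
    then show ?thesis
    proof cases
      case 1
      have "(\<Sum>j<2*k+1. w powi (0 - int j)) = - w"
        using gi by (simp add: power_int_minus power_inverse)
      then show ?thesis
        unfolding 1 by (subst **) (auto simp: inj_def simp del: sum.lessThan_Suc)
    next
      case 2
      have "(\<Sum>j<2*k+1. w powi (1 - int j)) = w * - w"
        unfolding gi [symmetric] sum_distrib_left using \<open>w \<noteq> 0\<close>
        by (intro sum.cong) (simp_all add: power_int_diff power_inverse divide_inverse)
      moreover have "w powi (0 - int (2*k)) = w ^ 2"
        using inverse_unique [OF p] by (simp only: diff_0 power_int_minus power_int_of_nat)
      ultimately show ?thesis
        unfolding 2 by (subst **) (auto simp: inj_def power2_eq_square simp del: sum.lessThan_Suc)
    next
      case 3
      have "(\<Sum>i<2*k+1. w powi (int i - 0)) = - inverse w"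
        using gw by simp
      then show ?thesis
        unfolding 3 by (subst **) (auto simp: inj_def power_int_minus simp del: sum.lessThan_Suc)
    next
      case 4
      have "(\<Sum>i<2*k+1. w powi (int i - 1)) = - inverse w * inverse w"
        unfolding gw [symmetric] sum_distrib_right using \<open>w \<noteq> 0\<close>
        by (intro sum.cong) (simp_all add: power_int_diff divide_inverse)
      moreover have "w powi (int (2*k) - 0) = inverse w ^ 2"
        using inverse_unique [of "w ^ 2" "w ^ (2*k)"] p
        by (simp only: diff_0_right power_int_of_nat power_inverse mult.commute)
      ultimately show ?thesis
        unfolding 4 by (subst **) (auto simp: inj_def power2_eq_square simp del: sum.lessThan_Suc)
    qed
  qed
  obtain v P where P: "t = translate v P" "P \<in> base_tiles (2*k+2)"
    using t by (auto simp: tiles_def)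
  \<comment> \<open>Translation by v only multiplies the sum by the character value at v.\<close>
  have "(\<Sum>(i, j)\<in>t. w powi (i - j)) = (\<Sum>(i, j)\<in>P. w powi (fst v - snd v) * w powi (i - j))"
    unfolding P translate_eq using \<open>w \<noteq> 0\<close>
    by (subst sum.reindex) (auto simp: case_prod_beta simp flip: power_int_add
        intro!: sum.cong arg_cong [where f = "power_int w"])
  then show ?thesis
    using base [OF P(2)] by (simp add: case_prod_beta flip: sum_distrib_left)
qed

lemma admits_signed_tiling_rectangle_imp_dvd:
  assumes "admits_signed_tiling (tiles (2*k+2)) (constant_region (rectangle a b p q) (1::complex))"
  shows "2*k+2 dvd p \<or> 2*k+2 dvd q"
proof -
  define w where "w = exp (2 * of_real pi * \<i> / of_nat (2*k+2))"
  \<comment> \<open>The root w is primitive; this turns the vanishing of a geometric sum into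
    divisibility of a side.\<close>
  have w: "w ^ m = 1 \<longleftrightarrow> 2*k+2 dvd m" for m
    using complex_root_unity_eq_1 [of "2*k+2" m]
    by (simp add: w_def flip: exp_of_nat_mult) (simp add: mult_ac)
  have "w ^ (2*k+2) = 1" by (simp only: w dvd_refl)
  have "w \<noteq> 1" using w [of 1] by simp
  have "w \<noteq> 0" by (simp add: w_def)
  have "0 = (\<Sum>(i, j)\<in>rectangle a b p q. w powi (i - j))"
    using assms \<open>w ^ (2*k+2) = 1\<close> \<open>w \<noteq> 1\<close>
    by (intro signed_tiling_weighted_sum_eq_0 [symmetric, where T = "tiles (2*k+2)"]
        finite_rectangle finite_tile tile_character_sum_eq_0)
  also have "\<dots> = (\<Sum>(i, j)\<in>{..<p} \<times> {..<q}. w powi (a - b) * w ^ i * inverse w ^ j)"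
  proof -
    have "inj_on (\<lambda>(i, j). (a + int i, b + int j)) ({..<p} \<times> {..<q})"
      by (auto simp: inj_on_def)
    moreover have "w powi (a + int i - (b + int j)) = w powi (a - b) * w ^ i * inverse w ^ j" for i j
      using \<open>w \<noteq> 0\<close> by (simp add: power_int_add power_int_diff field_simps)
    ultimately show ?thesis
      unfolding rectangle_eq by (subst sum.reindex) (auto intro!: sum.cong)
  qed
  also have "\<dots> = (\<Sum>i<p. \<Sum>j<q. w powi (a - b) * w ^ i * inverse w ^ j)"
    by (rule sum.cartesian_product [symmetric])
  also have "\<dots> = w powi (a - b) * (\<Sum>i<p. w ^ i) * (\<Sum>j<q. inverse w ^ j)"
    by (simp only: mult.assoc sum_product) (simp only: sum_distrib_left)
  finally have "(\<Sum>i<p. w ^ i) = 0 \<or> (\<Sum>j<q. inverse w ^ j) = 0"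
    using \<open>w \<noteq> 0\<close> by auto
  then have "w ^ p = 1 \<or> inverse w ^ q = 1"
    using power_diff_1_eq [of w p] power_diff_1_eq [of "inverse w" q] by auto
  then show ?thesis by (simp add: w power_inverse)
qed

theorem theorem3:
  fixes n :: nat
  assumes "n \<ge> 6" and "even n"
  shows "(\<forall>(a::int) (b::int) (p::nat) (q::nat). p > 0 \<longrightarrow> q > 0 \<longrightarrow>
            (admits_signed_tiling (tiles n) (constant_region (rectangle a b p q) (1::complex))
               \<longleftrightarrow> n dvd p \<or> n dvd q)) \<and>
         (\<forall>(a::int) (b::int) (p::nat) (q::nat) (c::int). p > 0 \<longrightarrow> q > 0 \<longrightarrow>
            (n dvd p \<or> n dvd q) \<longrightarrow> (int n div 2 - 2) dvd c \<longrightarrow>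
            admits_signed_tiling (tiles n) (constant_region (rectangle a b p q) c))"
proof -
  define k where "k = n div 2 - 1"
  have n: "n = 2*k+2" and k: "k \<ge> 2" using assms by (auto simp: k_def)
  \<comment> \<open>This is where n at least 6 enters: for n = 4 the factor k - 1 would be
    0.\<close>
  have "(of_nat k - 1 :: complex) \<noteq> 0" using k by simp
  then have unit: "(of_nat k - 1 :: complex) dvd 1" by (simp add: dvd_field_iff)
  have half: "int n div 2 - 2 = of_nat k - 1" by (simp add: n)
  show ?thesis
    unfolding half unfolding n
  proof (intro conjI allI impI iffI)
    fix a b :: int and p q :: nat
    assume "admits_signed_tiling (tiles (2*k+2)) (constant_region (rectangle a b p q) (1::complex))"
    then show "2*k+2 dvd p \<or> 2*k+2 dvd q"
      by (rule admits_signed_tiling_rectangle_imp_dvd)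
  next
    fix a b :: int and p q :: nat
    assume "2*k+2 dvd p \<or> 2*k+2 dvd q"
    then show "admits_signed_tiling (tiles (2*k+2)) (constant_region (rectangle a b p q) (1::complex))"
      using unit by (rule admits_signed_tiling_rectangle)
  next
    fix a b c :: int and p q :: nat
    assume "2*k+2 dvd p \<or> 2*k+2 dvd q" and "of_nat k - 1 dvd c"
    then show "admits_signed_tiling (tiles (2*k+2)) (constant_region (rectangle a b p q) c)"
      by (rule admits_signed_tiling_rectangle)
  qed
qed

end
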